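(* Let $K=\mathbb{Q}(\sqrt{D})$ be a real quadratic number field with a square-free integer $D>0$, and let $G=\mathrm{Gal}(K/\mathbb{Q})$. Let $\epsilon>1$ be a fundamental unit of $K$. Then the following statements are equivalent: (1) $N(\epsilon)=-1$; (2) $\sharp\mathrm{H}^1(G,\mathbf{U}_K)=2$; (3) the equation $x^2-y^2D=-1$ in the case $D\equiv 2,3\pmod 4$ (respectively, the equation $(2x-y)^2-y^2D=-4$ in the case $D\equiv 1\pmod 4$) has integral solutions $(x,y)$.
   Context: $\mathbf{U}_K$ is the (multiplicative) unit group of the ring of integers of $K$, regarded as a $G$-module; $N=N_{K/\mathbb{Q}}$ is the norm from $K$ to $\mathbb{Q}$; $\sharp$ denotes cardinality. The fundamental unit $\epsilon>1$ is the smallest unit of $K$ greater than $1$, so that $\mathbf{U}_K=\langle -1\rangle\times\langle\epsilon\rangle$. *)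

theory Defs
  imports
    "HOL-Algebra.Algebra"
    "HOL-Algebra.Algebraic_Closure_Type"
    "HOL-Computational_Algebra.Computational_Algebra"
begin

section \<open>First cohomology of a group acting on an abelian group\<close>

text \<open>
  The abelian group \<open>A\<close> is written multiplicatively, and \<open>g\<close> acts on \<open>a\<close> by \<open>\<phi> g a\<close>.
  Cochains are extensional functions, so that a cochain is determined by its values on \<open>carrier G\<close>
  and the cardinality of the quotient is the right one.
\<close>

definition one_cocycles ::
  "('g, 'm) monoid_scheme \<Rightarrow> ('a, 'n) monoid_scheme \<Rightarrow> ('g \<Rightarrow> 'a \<Rightarrow> 'a) \<Rightarrow> ('g \<Rightarrow> 'a) set"
  where "one_cocycles G A \<phi> =
    {f \<in> carrier G \<rightarrow>\<^sub>E carrier A.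
       \<forall>g\<in>carrier G. \<forall>h\<in>carrier G. f (g \<otimes>\<^bsub>G\<^esub> h) = f g \<otimes>\<^bsub>A\<^esub> \<phi> g (f h)}"

definition one_coboundaries ::
  "('g, 'm) monoid_scheme \<Rightarrow> ('a, 'n) monoid_scheme \<Rightarrow> ('g \<Rightarrow> 'a \<Rightarrow> 'a) \<Rightarrow> ('g \<Rightarrow> 'a) set"
  where "one_coboundaries G A \<phi> =
    (\<lambda>a. \<lambda>g\<in>carrier G. \<phi> g a \<otimes>\<^bsub>A\<^esub> inv\<^bsub>A\<^esub> a) ` carrier A"

definition H1 ::
  "('g, 'm) monoid_scheme \<Rightarrow> ('a, 'n) monoid_scheme \<Rightarrow> ('g \<Rightarrow> 'a \<Rightarrow> 'a) \<Rightarrow> ('g \<Rightarrow> 'a) set monoid"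
  where "H1 G A \<phi> =
    (product_group (carrier G) (\<lambda>_. A))\<lparr>carrier := one_cocycles G A \<phi>\<rparr>
      Mod one_coboundaries G A \<phi>"


section \<open>Real quadratic fields\<close>

text \<open>
  Subfields \<open>K\<close> of the real numbers are records whose operations are those of the type
  \<^typ>\<open>real\<close>.
\<close>

definition quadratic_field :: "int \<Rightarrow> real ring"
  where "quadratic_field D =
    ring_of_type_algebra\<lparr>carrier :=
      generate_field ring_of_type_algebra (insert (sqrt (of_int D)) \<rat>)\<rparr>"

definition gal_group :: "real ring \<Rightarrow> (real \<Rightarrow> real) monoid"
  where "gal_group K = (BijGroup (carrier K))\<lparr>carrier :=
    {\<sigma> \<in> ring_hom K K \<inter> Bij (carrier K). \<forall>q\<in>\<rat>. \<sigma> q = q}\<rparr>"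

definition ring_of_integers :: "real ring \<Rightarrow> real ring"
  where "ring_of_integers K = K\<lparr>carrier := {x \<in> carrier K. algebraic_int x}\<rparr>"

definition unit_group :: "real ring \<Rightarrow> real monoid"
  where "unit_group K = units_of (ring_of_integers K)"

text \<open>
  The norm to \<open>\<rat>\<close> as the product of the Galois conjugates; this is the field norm when \<open>K\<close> is
  a finite Galois extension of \<open>\<rat>\<close>.
\<close>

definition galois_norm :: "real ring \<Rightarrow> real \<Rightarrow> real"
  where "galois_norm K x = (\<Prod>\<sigma>\<in>carrier (gal_group K). \<sigma> x)"

definition is_fundamental_unit :: "real ring \<Rightarrow> real \<Rightarrow> bool"
  where "is_fundamental_unit K \<epsilon> \<longleftrightarrow>
    \<epsilon> \<in> carrier (unit_group K) \<and> 1 < \<epsilon> \<and>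
    (\<forall>u\<in>carrier (unit_group K). 1 < u \<longrightarrow> \<epsilon> \<le> u)"

end

theory Submission
  imports Defs
begin

text \<open>
  Write \<open>\<sigma>\<close> for the nontrivial automorphism of \<open>K\<close> and \<open>N(u) = u \<sigma>(u)\<close>. Since \<open>G = {1, \<sigma>}\<close>, a cocycle is
  determined by its value at \<open>\<sigma>\<close>, an element of norm \<open>1\<close>, and \<open>H\<^sup>1(G, U)\<close> becomes the group of units of
  norm \<open>1\<close> modulo the quotients \<open>\<sigma>(a) / a = N(a) / a\<^sup>2\<close> (\<open>card_H1_order_two\<close>). The units are \<open>\<plusminus>\<epsilon>\<^sup>k\<close>. If
  \<open>N(\<epsilon>) = -1\<close>, those of norm \<open>1\<close> are \<open>\<plusminus>\<epsilon>\<^sup>2\<^sup>m\<close>, and modulo the elements \<open>(-1)\<^sup>m\<epsilon>\<^sup>2\<^sup>m\<close> only the two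
  classes of \<open>\<plusminus>1\<close> remain. If \<open>N(\<epsilon>) = 1\<close>, all units have norm \<open>1\<close> and the quotients \<open>\<sigma>(a) / a\<close> are the
  even powers of \<open>\<epsilon>\<close>; to see that the cardinality is not \<open>2\<close> it is enough that \<open>1\<close>, \<open>-1\<close> and \<open>\<epsilon>\<close> are
  in different classes (\<open>card_H1_eq_2_iff\<close>).

  For the Pell equation, \<open>N(\<epsilon>) = -1\<close> holds as soon as some unit has norm \<open>-1\<close>, because every unit is a
  power of \<open>\<epsilon>\<close> up to sign. The units are the numbers \<open>(t + s\<surd>D) / 2\<close> with \<open>t\<^sup>2 - Ds\<^sup>2 = \<plusminus>4\<close>
  (\<open>carrier_unit_group\<close>), so a unit of norm \<open>-1\<close> is a solution of \<open>t\<^sup>2 - Ds\<^sup>2 = -4\<close>; a parity argument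
  rewrites this equation as the one for the residue class of \<open>D\<close> modulo \<open>4\<close> (\<open>negative_pell_iff\<close>). The
  arithmetic input is the description of the algebraic integers of \<open>K\<close> by integral trace and norm,
  which comes from Gauss's lemma (\<open>primitive_minimal_poly_lead_coeff_unit\<close>).
\<close>

section \<open>Cohomology of a group of order two\<close>

text \<open>
  The group structure on the cochains is pointwise, so a cohomology class is a set of pointwise
  products.
\<close>

lemma carrier_H1:
  "carrier (H1 G A \<phi>) = (\<lambda>f. (\<lambda>h. \<lambda>g\<in>carrier G. h g \<otimes>\<^bsub>A\<^esub> f g) ` one_coboundaries G A \<phi>) ` one_cocycles G A \<phi>"
  unfolding H1_def FactGroup_def RCOSETS_def r_coset_def product_group_def by auto

text \<open>
  A cocycle \<open>f\<close> has \<open>f 1 = 1\<close>, so for a group \<open>{1, c}\<close> it is determined by \<open>v = f c\<close>, and the cocycle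
  condition at \<open>(c, c)\<close> says that \<open>v\<close> times its image under \<open>c\<close> is \<open>1\<close>; the other three conditions
  are then automatic. Evaluation at \<open>c\<close> thus turns the classes into the cosets, among the elements
  of norm one, of the subgroup of quotients \<open>\<phi> c a / a\<close>.
\<close>

lemma card_H1_order_two:
  assumes "group G" and "comm_group A" and carrier_G: "carrier G = {\<one>\<^bsub>G\<^esub>, c}" and "c \<noteq> \<one>\<^bsub>G\<^esub>"
    and \<phi>_one: "\<And>a. a \<in> carrier A \<Longrightarrow> \<phi> \<one>\<^bsub>G\<^esub> a = a" and \<phi>_hom: "\<phi> c \<in> hom A A"
  shows "card (carrier (H1 G A \<phi>)) =
    card ((\<lambda>v. ((\<lambda>a. \<phi> c a \<otimes>\<^bsub>A\<^esub> inv\<^bsub>A\<^esub> a) ` carrier A) #>\<^bsub>A\<^esub> v) ` {v \<in> carrier A. v \<otimes>\<^bsub>A\<^esub> \<phi> c v = \<one>\<^bsub>A\<^esub>})"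
    (is "_ = card ((\<lambda>v. ?W #>\<^bsub>A\<^esub> v) ` ?V)")
proof -
  interpret G: group G by fact
  interpret A: comm_group A by fact
  interpret \<phi>: group_hom A A "\<phi> c" using \<phi>_hom by unfold_locales
  let ?e = "\<one>\<^bsub>G\<^esub>" and ?Z = "one_cocycles G A \<phi>" and ?B = "one_coboundaries G A \<phi>"
  let ?ev = "\<lambda>f. f c"
  have c_G [simp]: "c \<in> carrier G" using carrier_G by simp
  have cc: "c \<otimes>\<^bsub>G\<^esub> c = ?e"
    using carrier_G G.m_closed[OF c_G c_G] G.l_cancel_one'[OF c_G c_G] \<open>c \<noteq> ?e\<close> by auto
  have fe: "f ?e = \<one>\<^bsub>A\<^esub>" if f: "f \<in> ?Z" for f
  proof -
    have fe: "f ?e \<in> carrier A" using f by (auto simp: one_cocycles_def)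
    have "f (?e \<otimes>\<^bsub>G\<^esub> ?e) = f ?e \<otimes>\<^bsub>A\<^esub> \<phi> ?e (f ?e)"
      using f G.one_closed unfolding one_cocycles_def by blast
    then show ?thesis using fe by (simp add: \<phi>_one)
  qed
  have ev_Z: "?ev ` ?Z = ?V"
  proof (intro equalityI subsetI)
    fix v assume "v \<in> ?ev ` ?Z"
    then obtain f where f: "f \<in> ?Z" and v: "v = f c" by auto
    have fc: "f c \<in> carrier A" using f by (auto simp: one_cocycles_def)
    have "f ?e = \<one>\<^bsub>A\<^esub>" using f by (rule fe)
    moreover have "f (c \<otimes>\<^bsub>G\<^esub> c) = f c \<otimes>\<^bsub>A\<^esub> \<phi> c (f c)"
      using f c_G unfolding one_cocycles_def by blast
    ultimately show "v \<in> ?V" using fc v cc by simp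
  next
    fix v assume v: "v \<in> ?V"
    define f where "f = (\<lambda>g\<in>carrier G. if g = ?e then \<one>\<^bsub>A\<^esub> else v)"
    have "f \<in> ?Z" unfolding one_cocycles_def
      using v \<open>c \<noteq> ?e\<close> cc by (auto simp: f_def carrier_G \<phi>_one)
    then show "v \<in> ?ev ` ?Z" using \<open>c \<noteq> ?e\<close> by (auto simp: f_def intro!: image_eqI[of _ _ f])
  qed
  have ev_B: "?ev ` ?B = ?W"
    unfolding one_coboundaries_def by (simp add: image_image)
  \<comment> \<open>Every class is a set of cochains from \<open>E\<close>, on which evaluation at \<open>c\<close> loses no information.\<close>
  define E where "E = {f \<in> extensional (carrier G). f ?e = \<one>\<^bsub>A\<^esub>}"
  have inj_ev: "inj_on ?ev E"
    by (rule inj_onI) (auto simp: E_def carrier_G intro!: extensionalityI[of _ "carrier G"])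
  have be: "h ?e = \<one>\<^bsub>A\<^esub>" if "h \<in> ?B" for h
    using that by (auto simp: one_coboundaries_def \<phi>_one A.r_inv)
  have "carrier (H1 G A \<phi>) \<subseteq> Pow E"
    by (auto simp: carrier_H1 E_def fe be)
  then have "inj_on ((`) ?ev) (carrier (H1 G A \<phi>))"
    using inj_on_image_Pow[OF inj_ev] inj_on_subset by blast
  then have "card (carrier (H1 G A \<phi>)) = card ((`) ?ev ` carrier (H1 G A \<phi>))"
    by (simp add: card_image)
  also have "(`) ?ev ` carrier (H1 G A \<phi>) = (\<lambda>f. ?W #>\<^bsub>A\<^esub> f c) ` ?Z"
    unfolding carrier_H1 image_image ev_B[symmetric] r_coset_def by (auto simp: image_iff)
  also have "\<dots> = (\<lambda>v. ?W #>\<^bsub>A\<^esub> v) ` ?V"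
    unfolding ev_Z[symmetric] image_image ..
  finally show ?thesis .
qed

section \<open>Integrality\<close>

abbreviation of_int_poly :: "int poly \<Rightarrow> real poly" where "of_int_poly \<equiv> map_poly of_int"

lemma of_int_poly_smult: "of_int_poly (smult c p) = smult (of_int c) (of_int_poly p)"
  by (rule poly_eqI) (simp add: coeff_map_poly)

lemma of_int_poly_add: "of_int_poly (p + q) = of_int_poly p + of_int_poly q"
  by (rule poly_eqI) (simp add: coeff_map_poly)

lemma of_int_poly_mult: "of_int_poly (p * q) = of_int_poly p * of_int_poly q"
  by (rule poly_eqI) (simp add: coeff_map_poly coeff_mult)

text \<open>
  A version of Gauss's lemma. Pseudo-division of a monic integral polynomial \<open>p\<close> with root \<open>x\<close> by \<open>q\<close>
  leaves a remainder that vanishes at \<open>x\<close>, hence is \<open>0\<close> by minimality: \<open>q\<close> divides a constant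
  multiple of \<open>p\<close>. Passing to primitive parts removes the constant, so \<open>q\<close> divides \<open>p\<close> up to sign and
  its leading coefficient divides \<open>1\<close>.
\<close>

lemma primitive_minimal_poly_lead_coeff_unit:
  fixes x :: real and q :: "int poly"
  assumes "algebraic_int x" and "content q = 1" and q_root: "poly (of_int_poly q) x = 0"
    and minimal: "\<And>r. poly (of_int_poly r) x = 0 \<Longrightarrow> degree r < degree q \<Longrightarrow> r = 0"
  shows "is_unit (lead_coeff q)"
proof -
  obtain p where p_root: "poly (of_int_poly p) x = 0" and monic: "lead_coeff p = 1"
    using \<open>algebraic_int x\<close> by (auto simp: algebraic_int_altdef_ipoly)
  have "q \<noteq> 0" using \<open>content q = 1\<close> by auto
  define r where "r = pseudo_mod p q"
  obtain a s where a: "a \<noteq> 0" and div: "smult a p = q * s + r"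
    using pseudo_mod(1)[OF \<open>q \<noteq> 0\<close>, of p] by (auto simp: r_def)
  have "poly (of_int_poly (smult a p)) x = poly (of_int_poly (q * s + r)) x" by (simp add: div)
  then have "poly (of_int_poly r) x = 0"
    using p_root q_root by (simp add: of_int_poly_smult of_int_poly_add of_int_poly_mult)
  moreover have "r = 0 \<or> degree r < degree q" using pseudo_mod(2)[OF \<open>q \<noteq> 0\<close>] r_def by auto
  ultimately have "r = 0" using minimal by blast
  have "content p dvd lead_coeff p" by (rule content_dvd_coeff)
  then have "content p = 1" by (metis is_unit_content_iff monic)
  then have "smult (unit_factor a) p = primitive_part (smult a p)"
    by (simp add: primitive_part_smult primitive_part_prim)
  also have "\<dots> = q * primitive_part s"
    using div \<open>r = 0\<close> \<open>content q = 1\<close> by (simp add: primitive_part_mult primitive_part_prim)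
  finally have "lead_coeff (smult (unit_factor a) p) = lead_coeff (q * primitive_part s)" by simp
  then have "unit_factor a = lead_coeff q * lead_coeff (primitive_part s)"
    using monic a by (simp add: lead_coeff_mult sgn_0_0)
  moreover have "is_unit (unit_factor a)" using a by simp
  ultimately show ?thesis by (metis dvd_mult_left)
qed

text \<open>
  If \<open>r = p / q\<close> is in lowest terms, then \<open>q\<^sup>2\<close> divides \<open>D\<close>.
\<close>

lemma squarefree_mult_square_int_imp_int:
  fixes D m :: int and r :: real
  assumes "squarefree D" and "r \<in> \<rat>" and r: "of_int D * r\<^sup>2 = of_int m"
  shows "r \<in> \<int>"
proof -
  obtain p q :: int where "q > 0" "coprime p q" and r_eq: "r = of_int p / of_int q"
    using \<open>r \<in> \<rat>\<close> by (rule Rats_cases')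
  have "of_int (D * p\<^sup>2) = (of_int (m * q\<^sup>2) :: real)"
    using r \<open>q > 0\<close> by (simp add: r_eq field_simps power2_eq_square)
  then have eq: "D * p\<^sup>2 = m * q\<^sup>2" by (simp only: of_int_eq_iff)
  then have "q\<^sup>2 dvd D * p\<^sup>2" by simp
  moreover have "coprime (q\<^sup>2) (p\<^sup>2)" using \<open>coprime p q\<close> by (simp add: coprime_commute)
  ultimately have "q\<^sup>2 dvd D" by (simp add: coprime_dvd_mult_left_iff)
  then have "is_unit q" using \<open>squarefree D\<close> by (auto simp: squarefree_def)
  then have "q = 1" using \<open>q > 0\<close> by simp
  then show ?thesis by (simp add: r_eq)
qed

section \<open>The field, its conjugation and its Galois group\<close>

locale real_quadratic =
  fixes D :: int
  assumes D_squarefree: "squarefree D" and D_pos: "D > 0" and D_neq_1: "D \<noteq> 1"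
begin

abbreviation w :: real where "w \<equiv> sqrt (of_int D)"
abbreviation K :: "real ring" where "K \<equiv> quadratic_field D"

lemma abs_D [simp]: "\<bar>real_of_int D\<bar> = of_int D"
  using D_pos by simp

lemma w_mult_w: "w * w = of_int D"
  using D_pos by simp

lemma w_mult_w_mult [simp]: "w * (w * x) = of_int D * x"
  using w_mult_w by (simp flip: mult.assoc)

lemma w_irrational: "w \<notin> \<rat>"
proof
  assume "w \<in> \<rat>"
  moreover have "algebraic_int w" by auto
  ultimately have "w \<in> \<int>" by (intro rational_algebraic_int_is_int)
  then obtain k where "w = of_int k" by (auto elim: Ints_cases)
  then have "of_int (k * k) = (of_int D :: real)" using w_mult_w by simp
  then have "D = k\<^sup>2" by (simp only: of_int_eq_iff power2_eq_square)
  then have "is_unit k" using D_squarefree by (auto simp: squarefree_def)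
  then show False using \<open>D = k\<^sup>2\<close> D_neq_1 by (auto simp: zdvd1_eq abs_if split: if_splits)
qed

lemma coords_unique:
  assumes "a \<in> \<rat>" "b \<in> \<rat>" "c \<in> \<rat>" "d \<in> \<rat>" and eq: "a + b * w = c + d * w"
  shows "a = c" and "b = d"
proof -
  show "b = d"
  proof (rule ccontr)
    assume "b \<noteq> d"
    then have "w = (c - a) / (b - d)" using eq by (simp add: field_simps)
    then show False using assms w_irrational by simp
  qed
  then show "a = c" using eq by simp
qed

lemma K_ops [simp]: "monoid.mult K = (*)" "monoid.one K = 1" "ring.zero K = 0" "ring.add K = (+)"
  by (simp_all add: quadratic_field_def ring_of_type_algebra_def)

text \<open>
  Inverses are the only operation that needs an argument: the inverse of \<open>h = a + b\<surd>D\<close> is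
  \<open>(a - b\<surd>D) / n\<close> with \<open>n = a\<^sup>2 - b\<^sup>2D\<close>, which is nonzero as \<open>\<surd>D\<close> is irrational.
\<close>

lemma carrier_K: "carrier K = {a + b * w |a b. a \<in> \<rat> \<and> b \<in> \<rat>}" (is "_ = ?S")
proof (intro equalityI subsetI)
  let ?R = "ring_of_type_algebra :: real ring"
  interpret R: field ?R by (rule field_from_type_algebra)
  have ops [simp]: "carrier ?R = UNIV" "monoid.mult ?R = (*)" "monoid.one ?R = 1" "ring.zero ?R = 0" "ring.add ?R = (+)"
    by (simp_all add: ring_of_type_algebra_def)
  have neg: "\<ominus>\<^bsub>?R\<^esub> x = - x" for x
    by (rule R.minus_equality) auto
  have inv: "inv\<^bsub>?R\<^esub> x = inverse x" if "x \<noteq> 0" for x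
    using that by (intro R.comm_inv_char) auto
  have S_I: "x \<in> ?S" if "a \<in> \<rat>" "b \<in> \<rat>" "x = a + b * w" for x a b
    using that by blast
  {
    fix x assume "x \<in> carrier K"
    then have "x \<in> generate_field ?R (insert w \<rat>)" by (simp add: quadratic_field_def)
    then show "x \<in> ?S"
    proof (induction rule: generate_field.induct)
      case one
      show ?case by (rule S_I[of 1 0]) simp_all
    next
      case (incl h)
      then show ?case using S_I[of 0 1 h] S_I[of h 0 h] by auto
    next
      case (a_inv h)
      then obtain a b where "a \<in> \<rat>" "b \<in> \<rat>" "h = a + b * w" by blast
      then show ?case unfolding neg by (intro S_I[of "- a" "- b"]) simp_all
    next
      case (m_inv h)
      then obtain a b where ab: "a \<in> \<rat>" "b \<in> \<rat>" and h: "h = a + b * w" by blast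
      have "h \<noteq> 0" using m_inv by simp
      define n where "n = a * a - b * b * of_int D"
      have "n \<in> \<rat>" using ab by (simp add: n_def)
      have n: "n = h * (a - b * w)" by (simp add: n_def h algebra_simps)
      have "a - b * w \<noteq> 0"
      proof
        assume "a - b * w = 0"
        then have "a + (- b) * w = 0 + 0 * w" by simp
        then have "a = 0" "- b = 0" using coords_unique[of a "- b" 0 0] ab by auto
        then show False using \<open>h \<noteq> 0\<close> h by simp
      qed
      then have "inverse h = a / n + (- b / n) * w" 
        using \<open>h \<noteq> 0\<close> unfolding n by (simp add: divide_simps)
      moreover have "a / n \<in> \<rat>" "- b / n \<in> \<rat>" using ab \<open>n \<in> \<rat>\<close> by simp_all
      ultimately show ?case unfolding inv[OF \<open>h \<noteq> 0\<close>] by (intro S_I[of "a / n" "- b / n"])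
    next
      case (eng_add h1 h2)
      then obtain a b c d where ab: "a \<in> \<rat>" "b \<in> \<rat>" "h1 = a + b * w"
        and cd: "c \<in> \<rat>" "d \<in> \<rat>" "h2 = c + d * w" by blast
      then show ?case by (intro S_I[of "a + c" "b + d"]) (simp_all add: algebra_simps)
    next
      case (eng_mult h1 h2)
      then obtain a b c d where ab: "a \<in> \<rat>" "b \<in> \<rat>" "h1 = a + b * w"
        and cd: "c \<in> \<rat>" "d \<in> \<rat>" "h2 = c + d * w" by blast
      then have "h1 * h2 = (a * c + b * d * of_int D) + (a * d + b * c) * w"
        by (simp add: algebra_simps)
      moreover have "a * c + b * d * of_int D \<in> \<rat>" "a * d + b * c \<in> \<rat>" using ab cd by simp_all
      ultimately show ?case unfolding ops by (intro S_I)
    qed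
  next
    fix x assume "x \<in> ?S"
    then obtain a b where ab: "a \<in> \<rat>" "b \<in> \<rat>" and x: "x = a + b * w" by blast
    have "a \<oplus>\<^bsub>?R\<^esub> b \<otimes>\<^bsub>?R\<^esub> w \<in> generate_field ?R (insert w \<rat>)"
      using ab by (intro generate_field.eng_add generate_field.eng_mult generate_field.incl) auto
    then show "x \<in> carrier K" by (simp add: quadratic_field_def x)
  }
qed

lemma in_K: "a \<in> \<rat> \<Longrightarrow> b \<in> \<rat> \<Longrightarrow> a + b * w \<in> carrier K"
  by (auto simp: carrier_K)

text \<open>
  The value outside \<open>K\<close> is \<open>undefined\<close>, because the elements of the Galois group are extensional
  functions on \<open>K\<close>.
\<close>

definition conjugation :: "real \<Rightarrow> real"
  where "conjugation = (\<lambda>x\<in>carrier K. THE y. \<exists>a\<in>\<rat>. \<exists>b\<in>\<rat>. x = a + b * w \<and> y = a - b * w)"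

lemma conjugation_eq: 
  assumes "a \<in> \<rat>" "b \<in> \<rat>"
  shows "conjugation (a + b * w) = a - b * w"
proof -
  have "(THE y. \<exists>c\<in>\<rat>. \<exists>d\<in>\<rat>. a + b * w = c + d * w \<and> y = c - d * w) = a - b * w"
  proof (rule the_equality)
    show "\<exists>c\<in>\<rat>. \<exists>d\<in>\<rat>. a + b * w = c + d * w \<and> a - b * w = c - d * w"
      using assms by (intro bexI[of _ a] bexI[of _ b]) simp_all
  next
    fix y assume "\<exists>c\<in>\<rat>. \<exists>d\<in>\<rat>. a + b * w = c + d * w \<and> y = c - d * w"
    then obtain c d where cd: "c \<in> \<rat>" "d \<in> \<rat>" "a + b * w = c + d * w" and y: "y = c - d * w" by blast
    then show "y = a - b * w" using coords_unique[OF assms cd] by simp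
  qed
  then show ?thesis using in_K[OF assms] by (simp add: conjugation_def)
qed

lemma K_coords:
  assumes "x \<in> carrier K"
  obtains a b where "a \<in> \<rat>" "b \<in> \<rat>" "x = a + b * w" "conjugation x = a - b * w"
proof -
  obtain a b where ab: "a \<in> \<rat>" "b \<in> \<rat>" and x: "x = a + b * w" using assms by (auto simp: carrier_K)
  show thesis by (rule that[OF ab x]) (simp add: x conjugation_eq[OF ab])
qed

lemma conjugation_closed:
  assumes "x \<in> carrier K"
  shows "conjugation x \<in> carrier K"
proof -
  obtain a b where ab: "a \<in> \<rat>" "b \<in> \<rat>" "conjugation x = a - b * w" using K_coords[OF assms] by blast
  then show ?thesis using in_K[of a "- b"] by simp
qed

lemma conjugation_involution:
  assumes "x \<in> carrier K"
  shows "conjugation (conjugation x) = x"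
proof -
  obtain a b where ab: "a \<in> \<rat>" "b \<in> \<rat>" "x = a + b * w" "conjugation x = a - b * w"
    using K_coords[OF assms] by blast
  then show ?thesis using conjugation_eq[of a "- b"] by simp
qed

lemma K_mult_closed:
  assumes "x \<in> carrier K" "y \<in> carrier K"
  shows "x * y \<in> carrier K" and conjugation_mult: "conjugation (x * y) = conjugation x * conjugation y"
proof -
  obtain a b where ab: "a \<in> \<rat>" "b \<in> \<rat>" "x = a + b * w" "conjugation x = a - b * w"
    using K_coords[OF assms(1)] by blast
  obtain c d where cd: "c \<in> \<rat>" "d \<in> \<rat>" "y = c + d * w" "conjugation y = c - d * w"
    using K_coords[OF assms(2)] by blast
  have eq: "x * y = (a * c + b * d * of_int D) + (a * d + b * c) * w"
    by (simp add: ab cd algebra_simps)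
  have rat: "a * c + b * d * of_int D \<in> \<rat>" "a * d + b * c \<in> \<rat>" using ab cd by simp_all
  show "x * y \<in> carrier K" unfolding eq using rat by (rule in_K)
  have "conjugation x * conjugation y = (a * c + b * d * of_int D) - (a * d + b * c) * w"
    unfolding ab(4) cd(4) by (simp add: algebra_simps)
  then show "conjugation (x * y) = conjugation x * conjugation y"
    unfolding eq conjugation_eq[OF rat] by simp
qed

lemma K_add_closed:
  assumes "x \<in> carrier K" "y \<in> carrier K"
  shows "x + y \<in> carrier K" and conjugation_add: "conjugation (x + y) = conjugation x + conjugation y"
proof -
  obtain a b where ab: "a \<in> \<rat>" "b \<in> \<rat>" "x = a + b * w" "conjugation x = a - b * w"
    using K_coords[OF assms(1)] by blast
  obtain c d where cd: "c \<in> \<rat>" "d \<in> \<rat>" "y = c + d * w" "conjugation y = c - d * w"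
    using K_coords[OF assms(2)] by blast
  have eq: "x + y = (a + c) + (b + d) * w" by (simp add: ab cd algebra_simps)
  have rat: "a + c \<in> \<rat>" "b + d \<in> \<rat>" using ab cd by simp_all
  show "x + y \<in> carrier K" unfolding eq using rat by (rule in_K)
  show "conjugation (x + y) = conjugation x + conjugation y"
    unfolding eq conjugation_eq[OF rat] ab(4) cd(4) by (simp add: algebra_simps)
qed

lemma conjugation_rat: "a \<in> \<rat> \<Longrightarrow> conjugation a = a"
  using conjugation_eq[of a 0] by simp

lemma conjugation_w: "conjugation w = - w"
  using conjugation_eq[of 0 1] by simp

lemma w_in_K: "w \<in> carrier K"
  using in_K[of 0 1] by simp

lemma rat_in_K: "a \<in> \<rat> \<Longrightarrow> a \<in> carrier K"
  using in_K[of a 0] by simp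

text \<open>
  An automorphism over \<open>\<rat>\<close> is determined by the image of \<open>\<surd>D\<close>, which must be a square root of \<open>D\<close>.
\<close>

lemma carrier_gal_group: "carrier (gal_group K) = {\<lambda>x\<in>carrier K. x, conjugation}"
proof (intro equalityI subsetI)
  fix \<sigma> assume "\<sigma> \<in> carrier (gal_group K)"
  then have hom: "\<sigma> \<in> ring_hom K K" and Bij: "\<sigma> \<in> Bij (carrier K)" and rat: "\<And>q. q \<in> \<rat> \<Longrightarrow> \<sigma> q = q"
    by (auto simp: gal_group_def)
  have \<sigma>_mult: "\<sigma> (x * y) = \<sigma> x * \<sigma> y" and \<sigma>_add: "\<sigma> (x + y) = \<sigma> x + \<sigma> y"
    if "x \<in> carrier K" "y \<in> carrier K" for x y
    using ring_hom_mult[OF hom that] ring_hom_add[OF hom that] by simp_all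
  have \<sigma>_coords: "\<sigma> (a + b * w) = a + b * \<sigma> w" if "a \<in> \<rat>" "b \<in> \<rat>" for a b
    using that by (simp add: \<sigma>_add \<sigma>_mult rat rat_in_K w_in_K K_mult_closed)
  have "\<sigma> w * \<sigma> w = \<sigma> (w * w)" using \<sigma>_mult[OF w_in_K w_in_K] by simp
  also have "\<dots> = w * w" unfolding w_mult_w by (rule rat) simp
  finally have "\<sigma> w = w \<or> \<sigma> w = - w" by (simp only: square_eq_iff)
  then show "\<sigma> \<in> {\<lambda>x\<in>carrier K. x, conjugation}"
  proof
    assume "\<sigma> w = w"
    then have "\<sigma> x = x" if "x \<in> carrier K" for x
      using that by (auto simp: carrier_K \<sigma>_coords)
    then have "\<sigma> = (\<lambda>x\<in>carrier K. x)"
      using Bij by (intro extensionalityI[of _ "carrier K"]) (auto simp: Bij_def)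
    then show ?thesis by simp
  next
    assume "\<sigma> w = - w"
    then have "\<sigma> x = conjugation x" if "x \<in> carrier K" for x
      using that by (auto simp: carrier_K \<sigma>_coords conjugation_eq)
    then have "\<sigma> = conjugation"
      using Bij by (intro extensionalityI[of _ "carrier K"]) (auto simp: Bij_def conjugation_def)
    then show ?thesis by simp
  qed
next
  fix \<sigma> assume "\<sigma> \<in> {\<lambda>x\<in>carrier K. x, conjugation}"
  moreover have "(\<lambda>x\<in>carrier K. x) \<in> carrier (gal_group K)"
    using id_Bij[of "carrier K"] by (auto simp: gal_group_def ring_hom_def rat_in_K K_mult_closed K_add_closed)
  moreover have "conjugation \<in> carrier (gal_group K)"
  proof -
    have "bij_betw conjugation (carrier K) (carrier K)"
      by (rule bij_betwI[of _ _ _ conjugation]) (auto simp: conjugation_closed conjugation_involution)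
    moreover have "conjugation \<in> extensional (carrier K)" by (simp add: conjugation_def)
    ultimately show ?thesis
      by (auto simp: gal_group_def ring_hom_def Bij_def conjugation_closed conjugation_mult conjugation_add conjugation_rat)
  qed
  ultimately show "\<sigma> \<in> carrier (gal_group K)" by auto
qed

lemma conjugation_neq_id: "conjugation \<noteq> (\<lambda>x\<in>carrier K. x)"
proof
  assume "conjugation = (\<lambda>x\<in>carrier K. x)"
  then have "conjugation w = w" by (simp add: w_in_K)
  then show False using D_pos by (simp add: conjugation_w)
qed

lemma one_gal_group [simp]: "\<one>\<^bsub>gal_group K\<^esub> = (\<lambda>x\<in>carrier K. x)"
  by (simp add: gal_group_def BijGroup_def)

lemma group_gal_group: "group (gal_group K)"
proof -
  let ?B = "BijGroup (carrier K)" and ?i = "\<lambda>x\<in>carrier K. x"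
  interpret B: group ?B by (rule group_BijGroup)
  have sub: "carrier (gal_group K) \<subseteq> Bij (carrier K)" by (auto simp: gal_group_def)
  have "conjugation \<in> Bij (carrier K)" using sub carrier_gal_group by auto
  then have "conjugation \<otimes>\<^bsub>?B\<^esub> conjugation = compose (carrier K) conjugation conjugation"
    by (simp add: BijGroup_def)
  also have "\<dots> = ?i"
    by (auto simp: compose_def conjugation_involution)
  finally have cc: "conjugation \<otimes>\<^bsub>?B\<^esub> conjugation = \<one>\<^bsub>?B\<^esub>" by (simp add: BijGroup_def)
  have B: "carrier ?B = Bij (carrier K)" "\<one>\<^bsub>?B\<^esub> = ?i" by (simp_all add: BijGroup_def)
  have cB: "conjugation \<in> carrier ?B" using sub B carrier_gal_group by auto
  have "inv\<^bsub>?B\<^esub> conjugation = conjugation" by (rule B.inv_equality[OF cc cB cB])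
  then have "subgroup {?i, conjugation} ?B"
    using cB cc by (intro B.subgroupI) (auto simp flip: B(2))
  then have "group (?B\<lparr>carrier := {?i, conjugation}\<rparr>)" by (rule B.subgroup_imp_group)
  also have "?B\<lparr>carrier := {?i, conjugation}\<rparr> = gal_group K"
    unfolding carrier_gal_group[symmetric] by (simp add: gal_group_def)
  finally show ?thesis .
qed

lemma galois_norm_eq: "x \<in> carrier K \<Longrightarrow> galois_norm K x = x * conjugation x"
  unfolding galois_norm_def carrier_gal_group using conjugation_neq_id by simp


section \<open>Integers and units\<close>

lemma not_four_dvd_D: "\<not> 4 dvd D"
proof
  assume "4 dvd D"
  then have "2\<^sup>2 dvd D" by simp
  then have "is_unit (2::int)" using D_squarefree unfolding squarefree_def by blast
  then show False by simp
qed

text \<open>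
  For \<open>b \<noteq> 0\<close>, clear denominators in \<open>X\<^sup>2 - 2aX + n\<close>, where \<open>n = a\<^sup>2 - b\<^sup>2D\<close>, and take the primitive
  part \<open>g\<close>. As \<open>x = a + b\<surd>D\<close> is irrational, \<open>g\<close> has minimal degree among the integral polynomials
  with root \<open>x\<close>, so its leading coefficient is a unit, and \<open>2a\<close> and \<open>n\<close> are integers.
\<close>

lemma trace_and_norm_integral:
  assumes "a \<in> \<rat>" "b \<in> \<rat>" and int: "algebraic_int (a + b * w)"
  shows "2 * a \<in> \<int> \<and> a\<^sup>2 - of_int D * b\<^sup>2 \<in> \<int>"
proof (cases "b = 0")
  case True
  then have "a \<in> \<int>" using int \<open>a \<in> \<rat>\<close> by (auto intro: rational_algebraic_int_is_int)
  then show ?thesis using True by simp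
next
  case False
  define x n where "x = a + b * w" and "n = a\<^sup>2 - of_int D * b\<^sup>2"
  have "2 * a \<in> \<rat>" using assms by simp
  then obtain p q :: int where q: "q > 0" and a: "2 * a = of_int p / of_int q"
    by (elim Rats_cases')
  have "n \<in> \<rat>" using assms by (simp add: n_def)
  then obtain p' q' :: int where q': "q' > 0" and n: "n = of_int p' / of_int q'"
    by (elim Rats_cases')
  have x: "x\<^sup>2 = 2 * a * x - n"
    by (simp add: x_def n_def power2_eq_square algebra_simps)
  define f where "f = [:p' * q, - (p * q'), q * q':]"
  define g where "g = primitive_part f"
  have f_eq: "f = smult (content f) g" by (simp add: g_def)
  have "f \<noteq> 0" using q q' by (simp add: f_def)
  have "degree g = 2" using q q' by (simp add: g_def f_def)
  have "poly (of_int_poly f) x = of_int (q * q') * (x\<^sup>2 - 2 * a * x + n)"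
    using q q' unfolding a n f_def by (simp add: map_poly_pCons field_simps power2_eq_square)
  then have "poly (of_int_poly f) x = 0" by (simp add: x)
  then have "of_int (content f) * poly (of_int_poly g) x = 0"
    by (subst (asm) f_eq) (simp add: of_int_poly_smult)
  then have root: "poly (of_int_poly g) x = 0" using \<open>f \<noteq> 0\<close> by simp
  have "is_unit (lead_coeff g)"
  proof (rule primitive_minimal_poly_lead_coeff_unit)
    show "algebraic_int x" using int by (simp add: x_def)
    show "content g = 1" using \<open>f \<noteq> 0\<close> by (simp add: g_def)
    show "poly (of_int_poly g) x = 0" by (rule root)
    fix r :: "int poly" assume r: "poly (of_int_poly r) x = 0" "degree r < degree g"
    then have "degree r \<le> 1" using \<open>degree g = 2\<close> by simp
    then obtain c d where r_eq: "r = [:c, d:]" 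
      by (cases r rule: pCons_cases; cases "degree r = 0") (auto elim!: degree_eq_zeroE simp: degree_pCons_eq_if split: if_splits)
    have "(of_int c + of_int d * a) + (of_int d * b) * w = 0 + 0 * w"
      using r(1) by (simp add: r_eq x_def map_poly_pCons algebra_simps)
    then have "of_int c + of_int d * a = 0" "of_int d * b = 0"
      using coords_unique[of "of_int c + of_int d * a" "of_int d * b" 0 0] assms by simp_all
    then show "r = 0" using False by (simp add: r_eq)
  qed
  moreover have "lead_coeff f = content f * lead_coeff g"
    by (metis f_eq lead_coeff_smult)
  moreover have "lead_coeff f = q * q'" using q q' by (simp add: f_def)
  ultimately have "q * q' dvd content f" by (metis mult_unit_dvd_iff dvd_refl)
  moreover have "content f dvd coeff f i" for i by simp
  ultimately have "q * q' dvd coeff f i" for i using dvd_trans by blast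
  from this[of 0] this[of 1] have "q' dvd p'" "q dvd p" using q q' by (simp_all add: f_def mult.commute)
  then show ?thesis unfolding n_def[symmetric] a n by (auto elim!: dvdE)
qed

text \<open>
  An integer of \<open>K\<close> has integral trace \<open>t = 2a\<close> and norm \<open>n = (t\<^sup>2 - D(2b)\<^sup>2) / 4\<close>. Hence \<open>D(2b)\<^sup>2\<close> is an
  integer, and \<open>s = 2b\<close> is one since \<open>D\<close> is squarefree. Writing the integers in half-integral
  coordinates with a congruence modulo \<open>4\<close> treats all residue classes of \<open>D\<close> at once.
\<close>

lemma carrier_ring_of_integers:
  "carrier (ring_of_integers K) =
    {of_int t / 2 + of_int s / 2 * w |t s. 4 dvd t\<^sup>2 - D * s\<^sup>2}" (is "_ = ?S")
proof (intro equalityI subsetI)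
  fix x assume "x \<in> carrier (ring_of_integers K)"
  then have "x \<in> carrier K" and int: "algebraic_int x" by (auto simp: ring_of_integers_def)
  then obtain a b where ab: "a \<in> \<rat>" "b \<in> \<rat>" and x: "x = a + b * w" using K_coords by blast
  obtain t n where t: "2 * a = of_int t" and n: "a\<^sup>2 - of_int D * b\<^sup>2 = of_int n"
    using trace_and_norm_integral[OF ab] int x by (auto elim!: Ints_cases)
  have Db: "of_int D * (2 * b)\<^sup>2 = (2 * a)\<^sup>2 - 4 * (a\<^sup>2 - of_int D * b\<^sup>2)"
    by (simp add: power2_eq_square algebra_simps)
  then have "of_int D * (2 * b)\<^sup>2 = of_int (t\<^sup>2 - 4 * n)" unfolding t n by simp
  moreover have "2 * b \<in> \<rat>" using ab by simp
  ultimately have "2 * b \<in> \<int>" using squarefree_mult_square_int_imp_int[OF D_squarefree] by blast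
  then obtain s where s: "2 * b = of_int s" by (auto elim: Ints_cases)
  have "of_int (D * s\<^sup>2) = (of_int (t\<^sup>2 - 4 * n) :: real)"
    using Db unfolding t n s by simp
  then have "t\<^sup>2 - D * s\<^sup>2 = 4 * n" unfolding of_int_eq_iff by simp
  moreover have "x = of_int t / 2 + of_int s / 2 * w" unfolding x t[symmetric] s[symmetric] by simp
  ultimately show "x \<in> ?S" by force
next
  fix x assume "x \<in> ?S"
  then obtain t s n where x: "x = of_int t / 2 + of_int s / 2 * w" and n: "t\<^sup>2 - D * s\<^sup>2 = 4 * n"
    by (auto elim: dvdE)
  have "x\<^sup>2 - of_int t * x + of_int (t\<^sup>2 - D * s\<^sup>2) / 4 = 0"
    by (simp add: x power2_eq_square field_simps)
  then have root: "x\<^sup>2 - of_int t * x + of_int n = 0" by (simp add: n)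
  have "algebraic_int x"
  proof (rule algebraic_int.intros)
    show "lead_coeff [:of_int n, - of_int t, 1 :: real:] = 1" by simp
    show "\<forall>i. coeff [:of_int n, - of_int t, 1 :: real:] i \<in> \<int>"
      by (simp add: coeff_pCons split: nat.split)
    show "poly [:of_int n, - of_int t, 1:] x = 0"
      using root by (simp add: algebra_simps power2_eq_square)
  qed
  moreover have "x \<in> carrier K" unfolding x by (rule in_K) simp_all
  ultimately show "x \<in> carrier (ring_of_integers K)" by (simp add: ring_of_integers_def)
qed

text \<open>
  The parities that make the coordinates of a product of two integers half-integral again.
\<close>

lemma parity:
  assumes "4 dvd t\<^sup>2 - D * s\<^sup>2"
  shows "even t \<longleftrightarrow> even s" and "even D \<Longrightarrow> even s"
proof -
  have "even (t\<^sup>2 - D * s\<^sup>2)" using assms by (rule dvd_trans[rotated]) simp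
  then have ts: "even t \<longleftrightarrow> even D \<or> even s" by auto
  show D: "even s" if "even D"
  proof -
    obtain d where d: "D = 2 * d" using \<open>even D\<close> by blast
    obtain r where r: "t = 2 * r" using ts \<open>even D\<close> by blast
    obtain k where "t\<^sup>2 - D * s\<^sup>2 = 4 * k" using assms by blast
    then have "d * s\<^sup>2 = 2 * (r\<^sup>2 - k)" by (simp add: d r power2_eq_square)
    then have "even (d * s\<^sup>2)" by simp
    moreover have "odd d" using not_four_dvd_D d by auto
    ultimately show ?thesis by simp
  qed
  show "even t \<longleftrightarrow> even s" using ts D by blast
qed

lemma integers_mult_closed:
  assumes "x \<in> carrier (ring_of_integers K)" "y \<in> carrier (ring_of_integers K)"
  shows "x * y \<in> carrier (ring_of_integers K)"
proof -
  obtain t s where x: "x = of_int t / 2 + of_int s / 2 * w" and ts: "4 dvd t\<^sup>2 - D * s\<^sup>2"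
    using assms(1) by (auto simp: carrier_ring_of_integers)
  obtain t' s' where y: "y = of_int t' / 2 + of_int s' / 2 * w" and ts': "4 dvd t'\<^sup>2 - D * s'\<^sup>2"
    using assms(2) by (auto simp: carrier_ring_of_integers)
  have "even (t * t' + D * s * s')" "even (t * s' + s * t')"
    using parity[OF ts] parity[OF ts'] by auto
  then obtain T S where T: "t * t' + D * s * s' = 2 * T" and S: "t * s' + s * t' = 2 * S"
    by (elim evenE) (rule that)
  have "x * y = of_int (t * t' + D * s * s') / 4 + of_int (t * s' + s * t') / 4 * w"
    by (simp add: x y field_simps)
  then have xy: "x * y = of_int T / 2 + of_int S / 2 * w" unfolding T S by simp
  have "(2 * T)\<^sup>2 - D * (2 * S)\<^sup>2 = (t\<^sup>2 - D * s\<^sup>2) * (t'\<^sup>2 - D * s'\<^sup>2)"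
    unfolding T[symmetric] S[symmetric] by (simp add: power2_eq_square algebra_simps)
  moreover have "4 * 4 dvd (t\<^sup>2 - D * s\<^sup>2) * (t'\<^sup>2 - D * s'\<^sup>2)"
    using ts ts' by (rule mult_dvd_mono)
  moreover have "(2 * T)\<^sup>2 - D * (2 * S)\<^sup>2 = 4 * (T\<^sup>2 - D * S\<^sup>2)"
    by (simp add: power_mult_distrib algebra_simps)
  ultimately have "4 * 4 dvd 4 * (T\<^sup>2 - D * S\<^sup>2)" by (simp only:)
  then have "4 dvd T\<^sup>2 - D * S\<^sup>2" by (simp only: dvd_mult_cancel_left) simp
  then show ?thesis unfolding carrier_ring_of_integers xy by blast
qed

lemma integers_ops [simp]: "monoid.mult (ring_of_integers K) = (*)" "monoid.one (ring_of_integers K) = 1"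
  by (simp_all add: ring_of_integers_def)

lemma comm_group_unit_group: "comm_group (unit_group K)"
proof -
  let ?O = "ring_of_integers K"
  have "comm_monoid ?O"
    by (rule comm_monoidI)
      (auto simp: integers_mult_closed ac_simps, auto simp: ring_of_integers_def rat_in_K)
  then show ?thesis unfolding unit_group_def by (rule comm_monoid.units_comm_group)
qed

lemma unit_group_ops [simp]: "monoid.mult (unit_group K) = (*)" "monoid.one (unit_group K) = 1"
  by (simp_all add: unit_group_def units_of_def)

lemma mult_conjugation_half_ints:
  assumes "x = of_int t / 2 + of_int s / 2 * w"
  shows "x * conjugation x = of_int (t\<^sup>2 - D * s\<^sup>2) / 4"
  unfolding assms by (subst conjugation_eq) (simp_all add: power2_eq_square field_simps)

text \<open>
  An integer of norm \<open>\<plusminus>1\<close> has its conjugate, up to sign, as inverse; conversely the norm of a unit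
  is a divisor of \<open>1\<close> in \<open>\<int>\<close>.
\<close>

lemma carrier_unit_group:
  "carrier (unit_group K) =
    {of_int t / 2 + of_int s / 2 * w |t s. t\<^sup>2 - D * s\<^sup>2 = 4 \<or> t\<^sup>2 - D * s\<^sup>2 = -4}" (is "_ = ?S")
proof (intro equalityI subsetI)
  let ?O = "ring_of_integers K"
  fix x assume "x \<in> carrier (unit_group K)"
  then obtain y where xO: "x \<in> carrier ?O" and yO: "y \<in> carrier ?O" and xy: "x * y = 1"
    by (auto simp: unit_group_def units_of_def Units_def)
  obtain t s n where x: "x = of_int t / 2 + of_int s / 2 * w" and n: "t\<^sup>2 - D * s\<^sup>2 = 4 * n"
    using xO by (auto simp: carrier_ring_of_integers elim: dvdE)
  obtain t' s' n' where y: "y = of_int t' / 2 + of_int s' / 2 * w" and n': "t'\<^sup>2 - D * s'\<^sup>2 = 4 * n'"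
    using yO by (auto simp: carrier_ring_of_integers elim: dvdE)
  have K: "x \<in> carrier K" "y \<in> carrier K" using xO yO by (auto simp: ring_of_integers_def)
  have "conjugation x * conjugation y = 1"
    using conjugation_mult[OF K] xy conjugation_rat[of 1] by simp
  moreover have "(x * conjugation x) * (y * conjugation y) = (x * y) * (conjugation x * conjugation y)"
    by (simp only: mult_ac)
  ultimately have "(x * conjugation x) * (y * conjugation y) = 1" using xy by simp
  then have "of_int (n * n') = (of_int 1 :: real)" using mult_conjugation_half_ints[OF x] mult_conjugation_half_ints[OF y] by (simp add: n n')
  then have "n * n' = 1" by (simp only: of_int_eq_iff)
  then have "n = 1 \<or> n = -1" by (auto simp: zmult_eq_1_iff)
  then show "x \<in> ?S" using x n by force
next
  fix x assume "x \<in> ?S"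
  then obtain t s where x: "x = of_int t / 2 + of_int s / 2 * w" 
    and "t\<^sup>2 - D * s\<^sup>2 = 4 \<or> t\<^sup>2 - D * s\<^sup>2 = -4" by blast
  then obtain e where e: "t\<^sup>2 - D * s\<^sup>2 = 4 * e" "e * e = 1" by force
  define y where "y = of_int (e * t) / 2 + of_int (- e * s) / 2 * w"
  have "x * y = of_int (e * (t\<^sup>2 - D * s\<^sup>2)) / 4"
    by (simp add: x y_def power2_eq_square field_simps)
  also have "e * (t\<^sup>2 - D * s\<^sup>2) = 4" using e by (simp add: mult.left_commute)
  finally have "x * y = 1" by simp
  moreover have "x \<in> carrier (ring_of_integers K)"
    unfolding carrier_ring_of_integers x using e by fastforce
  moreover have "(e * t)\<^sup>2 - D * (- e * s)\<^sup>2 = (e * e) * (t\<^sup>2 - D * s\<^sup>2)"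
    by (simp add: power2_eq_square algebra_simps)
  then have "4 dvd (e * t)\<^sup>2 - D * (- e * s)\<^sup>2" using e by simp
  then have "y \<in> carrier (ring_of_integers K)"
    unfolding carrier_ring_of_integers y_def by blast
  ultimately show "x \<in> carrier (unit_group K)"
    by (auto simp: unit_group_def units_of_def Units_def mult.commute)
qed

lemma unit_in_K: "u \<in> carrier (unit_group K) \<Longrightarrow> u \<in> carrier K"
  by (auto simp: unit_group_def units_of_def Units_def ring_of_integers_def)

lemma conjugation_unit:
  assumes "u \<in> carrier (unit_group K)"
  shows "conjugation u \<in> carrier (unit_group K)"
proof -
  obtain t s where u: "u = of_int t / 2 + of_int s / 2 * w" and N: "t\<^sup>2 - D * s\<^sup>2 = 4 \<or> t\<^sup>2 - D * s\<^sup>2 = -4"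
    using assms by (auto simp: carrier_unit_group)
  have "conjugation u = of_int t / 2 + of_int (- s) / 2 * w"
    unfolding u by (subst conjugation_eq) simp_all
  moreover have "t\<^sup>2 - D * (- s)\<^sup>2 = 4 \<or> t\<^sup>2 - D * (- s)\<^sup>2 = -4" using N by simp
  ultimately show ?thesis unfolding carrier_unit_group by blast
qed

lemma galois_norm_unit:
  assumes "u \<in> carrier (unit_group K)"
  shows "galois_norm K u = u * conjugation u" and "galois_norm K u = 1 \<or> galois_norm K u = -1"
    and "conjugation u = galois_norm K u / u" and "u \<noteq> 0"
proof -
  show eq: "galois_norm K u = u * conjugation u" using assms galois_norm_eq unit_in_K by simp
  obtain t s where u: "u = of_int t / 2 + of_int s / 2 * w" and "t\<^sup>2 - D * s\<^sup>2 = 4 \<or> t\<^sup>2 - D * s\<^sup>2 = -4"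
    using assms by (auto simp: carrier_unit_group)
  then show "galois_norm K u = 1 \<or> galois_norm K u = -1"
    unfolding eq mult_conjugation_half_ints[OF u] by (auto simp del: of_int_diff)
  then show "u \<noteq> 0" using eq by auto
  then show "conjugation u = galois_norm K u / u" by (simp add: eq)
qed

lemma galois_norm_mult:
  assumes "u \<in> carrier K" "v \<in> carrier K"
  shows "galois_norm K (u * v) = galois_norm K u * galois_norm K v"
  using assms by (simp add: galois_norm_eq K_mult_closed conjugation_mult)

lemma galois_norm_minus:
  assumes "u \<in> carrier K"
  shows "galois_norm K (- u) = galois_norm K u"
  using galois_norm_mult[OF rat_in_K[of "-1"] assms] galois_norm_eq[OF rat_in_K[of "-1"]] conjugation_rat[of "-1"]
  by simp

lemma unit_closed:
  shows unit_1: "1 \<in> carrier (unit_group K)"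
    and unit_mult: "u \<in> carrier (unit_group K) \<Longrightarrow> v \<in> carrier (unit_group K) \<Longrightarrow> u * v \<in> carrier (unit_group K)"
    and unit_inv: "u \<in> carrier (unit_group K) \<Longrightarrow> inv\<^bsub>unit_group K\<^esub> u = inverse u"
    and unit_inverse: "u \<in> carrier (unit_group K) \<Longrightarrow> inverse u \<in> carrier (unit_group K)"
    and unit_minus: "u \<in> carrier (unit_group K) \<Longrightarrow> - u \<in> carrier (unit_group K)"
proof -
  interpret U: comm_group "unit_group K" by (rule comm_group_unit_group)
  show "1 \<in> carrier (unit_group K)" using U.one_closed by simp
  show mult: "u \<in> carrier (unit_group K) \<Longrightarrow> v \<in> carrier (unit_group K) \<Longrightarrow> u * v \<in> carrier (unit_group K)"
    for u v using U.m_closed by simp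
  show inv: "inv\<^bsub>unit_group K\<^esub> u = inverse u" if "u \<in> carrier (unit_group K)" for u
    using U.r_inv[OF that] by (simp add: inverse_unique)
  show "u \<in> carrier (unit_group K) \<Longrightarrow> inverse u \<in> carrier (unit_group K)"
    using U.inv_closed inv by metis
  have "-1 = of_int (-2) / 2 + of_int 0 / 2 * w" "(-2)\<^sup>2 - D * 0\<^sup>2 = 4" by simp_all
  then have "-1 \<in> carrier (unit_group K)" unfolding carrier_unit_group by blast
  then show "u \<in> carrier (unit_group K) \<Longrightarrow> - u \<in> carrier (unit_group K)"
    using mult[of "-1" u] by simp
qed

lemma unit_power_int:
  assumes "u \<in> carrier (unit_group K)"
  shows "u powi k \<in> carrier (unit_group K)"
proof -
  have "v ^ n \<in> carrier (unit_group K)" if "v \<in> carrier (unit_group K)" for v n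
    using that by (induction n) (simp_all add: unit_1 unit_mult)
  then show ?thesis using assms unit_inverse by (simp add: power_int_def flip: power_inverse)
qed

lemma fundamental_unit_not_between:
  assumes "is_fundamental_unit K \<epsilon>" "u \<in> carrier (unit_group K)" "1 \<le> u" "u < \<epsilon>"
  shows "u = 1"
  using assms by (force simp: is_fundamental_unit_def)

text \<open>
  Dividing \<open>\<bar>u\<bar>\<close> by the largest power of \<open>\<epsilon>\<close> below it leaves a unit in \<open>[1, \<epsilon>)\<close>.
\<close>

lemma unit_eq_fundamental_unit_power:
  assumes \<epsilon>: "is_fundamental_unit K \<epsilon>" and u: "u \<in> carrier (unit_group K)"
  obtains k :: int where "\<bar>u\<bar> = \<epsilon> powi k"
proof
  have "1 < \<epsilon>" and \<epsilon>U: "\<epsilon> \<in> carrier (unit_group K)" using \<epsilon> by (auto simp: is_fundamental_unit_def)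
  have "u \<noteq> 0" using u by (rule galois_norm_unit)
  define k where "k = \<lfloor>log \<epsilon> \<bar>u\<bar>\<rfloor>"
  have powi: "\<epsilon> powi m = \<epsilon> powr of_int m" for m
    using \<open>1 < \<epsilon>\<close> by (simp add: powr_real_of_int')
  have u_eq: "\<bar>u\<bar> = \<epsilon> powr log \<epsilon> \<bar>u\<bar>" using \<open>1 < \<epsilon>\<close> \<open>u \<noteq> 0\<close> by simp
  have le: "\<epsilon> powi k \<le> \<bar>u\<bar>" unfolding powi 
    by (subst u_eq, rule powr_mono) (use \<open>1 < \<epsilon>\<close> in \<open>auto simp: k_def\<close>)
  have less: "\<bar>u\<bar> < \<epsilon> powi (k + 1)" unfolding powi
    by (subst u_eq, rule powr_less_mono) (use \<open>1 < \<epsilon>\<close> in \<open>simp_all add: k_def\<close>)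
  define v where "v = \<bar>u\<bar> * inverse (\<epsilon> powi k)"
  have pos: "\<epsilon> powi k > 0" using \<open>1 < \<epsilon>\<close> by simp
  have "v \<in> carrier (unit_group K)" unfolding v_def
    using u unit_minus by (intro unit_mult unit_inverse unit_power_int \<epsilon>U) (auto simp: abs_if)
  moreover have "1 \<le> v" using le pos by (simp add: v_def field_simps)
  moreover have "v < \<epsilon>" using less pos \<open>1 < \<epsilon>\<close> by (simp add: v_def field_simps power_int_add)
  ultimately have "v = 1" using \<epsilon> fundamental_unit_not_between by blast
  then show "\<bar>u\<bar> = \<epsilon> powi k" using pos by (simp add: v_def field_simps)
qed

text \<open>
  Up to sign and squares there are only the units \<open>1\<close> and \<open>\<epsilon>\<close>, and the norm ignores both signs and
  squares.
\<close>

lemma unit_mod_squares: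
  assumes \<epsilon>: "is_fundamental_unit K \<epsilon>" and u: "u \<in> carrier (unit_group K)"
  obtains v where "v \<in> carrier (unit_group K)" "\<bar>u\<bar> = v * v \<and> galois_norm K u = 1 \<or>
    \<bar>u\<bar> = v * v * \<epsilon> \<and> galois_norm K u = galois_norm K \<epsilon>"
proof -
  have "\<epsilon> \<noteq> 0" and \<epsilon>U: "\<epsilon> \<in> carrier (unit_group K)" using \<epsilon> by (auto simp: is_fundamental_unit_def)
  obtain k where k: "\<bar>u\<bar> = \<epsilon> powi k" using unit_eq_fundamental_unit_power[OF \<epsilon> u] .
  define v where "v = \<epsilon> powi (k div 2)"
  have v: "v \<in> carrier (unit_group K)" unfolding v_def using \<epsilon>U by (rule unit_power_int)
  then have vK: "v \<in> carrier K" "v * v \<in> carrier K" using unit_in_K K_mult_closed by auto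
  have "galois_norm K v * galois_norm K v = 1" using galois_norm_unit(2)[OF v] by auto
  then have Nvv: "galois_norm K (v * v) = 1" by (simp add: galois_norm_mult vK)
  have Nabs: "galois_norm K \<bar>u\<bar> = galois_norm K u"
    using galois_norm_minus u unit_in_K by (simp add: abs_if)
  have "k = k div 2 + k div 2 + k mod 2" by simp
  then have "\<bar>u\<bar> = \<epsilon> powi (k div 2 + k div 2 + k mod 2)" using k by simp
  also have "\<dots> = v * v * \<epsilon> powi (k mod 2)"
    by (simp only: v_def power_int_add[OF disjI1[OF \<open>\<epsilon> \<noteq> 0\<close>]])
  finally have "\<bar>u\<bar> = v * v * \<epsilon> powi (k mod 2)" .
  moreover have "k mod 2 = 0 \<or> k mod 2 = 1" by auto
  ultimately have "\<bar>u\<bar> = v * v \<or> \<bar>u\<bar> = v * v * \<epsilon>" by auto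
  then show thesis
    using that[OF v] Nabs Nvv galois_norm_mult[OF vK(2) unit_in_K[OF \<epsilon>U]] by auto
qed

lemma galois_norm_fundamental_unit_iff:
  assumes \<epsilon>: "is_fundamental_unit K \<epsilon>"
  shows "galois_norm K \<epsilon> = -1 \<longleftrightarrow> (\<exists>u\<in>carrier (unit_group K). galois_norm K u = -1)"
proof
  assume "galois_norm K \<epsilon> = -1"
  then show "\<exists>u\<in>carrier (unit_group K). galois_norm K u = -1"
    using \<epsilon> by (auto simp: is_fundamental_unit_def)
next
  assume "\<exists>u\<in>carrier (unit_group K). galois_norm K u = -1"
  then show "galois_norm K \<epsilon> = -1" using unit_mod_squares[OF \<epsilon>] by force
qed

section \<open>The negative Pell equation\<close>

lemma unit_norm_neg_iff:
  "(\<exists>u\<in>carrier (unit_group K). galois_norm K u = -1) \<longleftrightarrow> (\<exists>t s. t\<^sup>2 - D * s\<^sup>2 = -4)"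
proof
  assume "\<exists>u\<in>carrier (unit_group K). galois_norm K u = -1"
  then obtain u where u: "u \<in> carrier (unit_group K)" "u * conjugation u = -1"
    using galois_norm_unit(1) by force
  then obtain t s where "u = of_int t / 2 + of_int s / 2 * w" "t\<^sup>2 - D * s\<^sup>2 = 4 \<or> t\<^sup>2 - D * s\<^sup>2 = -4"
    by (auto simp: carrier_unit_group)
  then have "t\<^sup>2 - D * s\<^sup>2 = -4" using mult_conjugation_half_ints[of u t s] u(2) by (auto simp del: of_int_diff)
  then show "\<exists>t s. t\<^sup>2 - D * s\<^sup>2 = -4" by blast
next
  assume "\<exists>t s. t\<^sup>2 - D * s\<^sup>2 = -4"
  then obtain t s where ts: "t\<^sup>2 - D * s\<^sup>2 = -4" by blast
  let ?u = "of_int t / 2 + of_int s / 2 * w"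
  have u: "?u \<in> carrier (unit_group K)" using ts by (auto simp: carrier_unit_group)
  then have "galois_norm K ?u = -1" using mult_conjugation_half_ints[of ?u t s] ts by (simp add: galois_norm_unit(1))
  then show "\<exists>u\<in>carrier (unit_group K). galois_norm K u = -1" using u by blast
qed

text \<open>
  For \<open>D \<equiv> 2, 3 (mod 4)\<close> both \<open>t\<close> and \<open>s\<close> are even, and \<open>t = 2x\<close>, \<open>s = 2y\<close>. For \<open>D \<equiv> 1 (mod 4)\<close> they only
  have the same parity, and \<open>t = 2x - y\<close>, \<open>s = y\<close>.
\<close>

lemma negative_pell_iff:
  "(\<exists>t s. t\<^sup>2 - D * s\<^sup>2 = -4) \<longleftrightarrow>
    (D mod 4 \<in> {2, 3} \<longrightarrow> (\<exists>x y :: int. x\<^sup>2 - y\<^sup>2 * D = -1)) \<and>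
    (D mod 4 = 1 \<longrightarrow> (\<exists>x y :: int. (2 * x - y)\<^sup>2 - y\<^sup>2 * D = -4))" (is "?L \<longleftrightarrow> ?R")
proof
  assume ?L
  then obtain t s where ts: "t\<^sup>2 - D * s\<^sup>2 = -4" by blast
  then have "4 dvd t\<^sup>2 - D * s\<^sup>2" by simp
  note par = parity[OF this]
  show ?R
  proof (intro conjI impI)
    assume D: "D mod 4 \<in> {2, 3}"
    have "even s"
    proof (rule ccontr)
      assume "odd s"
      then have "odd t" "odd D" using par by auto
      moreover have "D mod 4 = 2 \<or> D mod 4 = 3" using D by simp
      ultimately have "D mod 4 = 3" by presburger
      have square: "z\<^sup>2 mod 4 = 1" if "odd z" for z :: int
      proof -
        obtain k where "z = 2 * k + 1" using \<open>odd z\<close> by (rule oddE)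
        then have "z\<^sup>2 = 1 + (k\<^sup>2 + k) * 4" by (simp add: power2_eq_square algebra_simps)
        then show ?thesis by (simp only: mod_mult_self1) simp
      qed
      have "s\<^sup>2 mod 4 = 1" "t\<^sup>2 mod 4 = 1"
        using square \<open>odd s\<close> \<open>odd t\<close> by blast+
      moreover have "t\<^sup>2 mod 4 = ((D mod 4) * (s\<^sup>2 mod 4)) mod 4"
      proof -
        have "t\<^sup>2 = D * s\<^sup>2 + 4 * (-1)" using ts by simp
        then show ?thesis by (metis mod_mult_eq mod_mult_self2)
      qed
      ultimately show False using \<open>D mod 4 = 3\<close> by simp
    qed
    then obtain x y where "t = 2 * x" "s = 2 * y" using par(1) by blast
    then have "x\<^sup>2 - y\<^sup>2 * D = -1" using ts by (simp add: power_mult_distrib algebra_simps)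
    then show "\<exists>x y :: int. x\<^sup>2 - y\<^sup>2 * D = -1" by blast
  next
    have "even (t + s)" using par(1) by simp
    then obtain x where "t + s = 2 * x" by blast
    then have "t = 2 * x - s" by simp
    then have "(2 * x - s)\<^sup>2 - s\<^sup>2 * D = -4" using ts by (simp add: mult.commute)
    then show "\<exists>x y :: int. (2 * x - y)\<^sup>2 - y\<^sup>2 * D = -4" by blast
  qed
next
  assume R: ?R
  have "D mod 4 \<noteq> 0" using not_four_dvd_D by (simp add: dvd_eq_mod_eq_0)
  then have "D mod 4 = 1 \<or> D mod 4 \<in> {2, 3}" by auto
  then show ?L
  proof
    assume "D mod 4 = 1"
    then obtain x y where "(2 * x - y)\<^sup>2 - y\<^sup>2 * D = -4" using R by blast
    then have "(2 * x - y)\<^sup>2 - D * y\<^sup>2 = -4" by (simp add: mult.commute)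
    then show ?L by blast
  next
    assume "D mod 4 \<in> {2, 3}"
    then obtain x y where "x\<^sup>2 - y\<^sup>2 * D = -1" using R by blast
    then have "(2 * x)\<^sup>2 - D * (2 * y)\<^sup>2 = -4" by (simp add: power_mult_distrib algebra_simps)
    then show ?L by blast
  qed
qed

section \<open>The first cohomology of the unit group\<close>

text \<open>
  The conjugate of a unit \<open>a\<close> is \<open>N(a) / a\<close>, so the subgroup of quotients of conjugates consists of the
  numbers \<open>N(a) / a\<^sup>2\<close>.
\<close>

lemma card_H1_unit_group:
  "card (carrier (H1 (gal_group K) (unit_group K) (\<lambda>\<sigma> u. \<sigma> u))) =
    card ((\<lambda>v. (\<lambda>a. galois_norm K a / a\<^sup>2 * v) ` carrier (unit_group K)) `
      {v \<in> carrier (unit_group K). galois_norm K v = 1})"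
proof -
  let ?U = "unit_group K"
  have hom: "conjugation \<in> hom ?U ?U"
    by (rule homI) (simp_all add: conjugation_unit conjugation_mult unit_in_K)
  have "card (carrier (H1 (gal_group K) ?U (\<lambda>\<sigma> u. \<sigma> u))) =
    card ((\<lambda>v. ((\<lambda>a. conjugation a \<otimes>\<^bsub>?U\<^esub> inv\<^bsub>?U\<^esub> a) ` carrier ?U) #>\<^bsub>?U\<^esub> v) `
      {v \<in> carrier ?U. v \<otimes>\<^bsub>?U\<^esub> conjugation v = \<one>\<^bsub>?U\<^esub>})"
    using carrier_gal_group conjugation_neq_id
    by (intro card_H1_order_two group_gal_group comm_group_unit_group hom) (simp_all add: unit_in_K)
  also have "(\<lambda>a. conjugation a \<otimes>\<^bsub>?U\<^esub> inv\<^bsub>?U\<^esub> a) ` carrier ?U = (\<lambda>a. galois_norm K a / a\<^sup>2) ` carrier ?U"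
    by (rule image_cong) (simp_all add: unit_inv galois_norm_unit(3) power2_eq_square divide_simps)
  also have "{v \<in> carrier ?U. v \<otimes>\<^bsub>?U\<^esub> conjugation v = \<one>\<^bsub>?U\<^esub>} = {v \<in> carrier ?U. galois_norm K v = 1}"
    using galois_norm_unit(1) by auto
  also have "r_coset ?U ((\<lambda>a. galois_norm K a / a\<^sup>2) ` carrier ?U) =
      (\<lambda>v. (\<lambda>a. galois_norm K a / a\<^sup>2 * v) ` carrier ?U)"
    by (rule ext) (auto simp: r_coset_def)
  finally show ?thesis .
qed

text \<open>
  Let \<open>W = {N(a) / a\<^sup>2}\<close>. Always \<open>-1 \<notin> W\<close>, because \<open>a\<^sup>2 = -N(a)\<close> forces \<open>a = \<plusminus>1\<close>, of norm \<open>1\<close>; so the classes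
  of \<open>\<plusminus>1\<close> are distinct. If \<open>N(\<epsilon>) = -1\<close>, a unit of norm \<open>1\<close> is \<open>\<plusminus>b\<^sup>2\<close> for a unit \<open>b\<close>, hence lies in \<open>W\<close> or
  \<open>-W\<close>, and there is no third class. If all units have norm \<open>1\<close>, then \<open>W\<close> consists of the squares, and
  \<open>\<epsilon>\<close> gives a third class: \<open>-\<epsilon>\<close> is negative, and a square root of \<open>\<epsilon>\<close> would be a unit strictly
  between \<open>1\<close> and \<open>\<epsilon>\<close>.
\<close>

lemma card_H1_eq_2_iff:
  assumes \<epsilon>: "is_fundamental_unit K \<epsilon>"
  shows "card (carrier (H1 (gal_group K) (unit_group K) (\<lambda>\<sigma> u. \<sigma> u))) = 2 \<longleftrightarrow> galois_norm K \<epsilon> = -1"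
proof -
  let ?U = "carrier (unit_group K)" and ?N = "galois_norm K"
  define coset where "coset v = (\<lambda>a. ?N a / a\<^sup>2 * v) ` ?U" for v
  define V where "V = {v \<in> ?U. ?N v = 1}"
  have card: "card (carrier (H1 (gal_group K) (unit_group K) (\<lambda>\<sigma> u. \<sigma> u))) = card (coset ` V)"
    by (simp add: card_H1_unit_group coset_def V_def)
  have "1 < \<epsilon>" and \<epsilon>U: "\<epsilon> \<in> ?U" using \<epsilon> by (auto simp: is_fundamental_unit_def)
  have N1: "?N 1 = 1" using galois_norm_eq[OF rat_in_K[of 1]] conjugation_rat[of 1] by simp
  then have Nm1: "?N (-1) = 1" using galois_norm_minus[OF rat_in_K[of 1]] by simp
  have V1: "1 \<in> V" "-1 \<in> V" using unit_1 unit_minus[OF unit_1] N1 Nm1 by (auto simp: V_def)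
  have self: "v \<in> coset v" for v
    unfolding coset_def using unit_1 N1 by (intro image_eqI[of _ _ 1]) auto
  have no_m1: "a\<^sup>2 \<noteq> - ?N a" if "a \<in> ?U" for a
  proof
    assume eq: "a\<^sup>2 = - ?N a"
    then have "?N a = -1" using galois_norm_unit(2)[OF that] by (smt (verit) zero_le_power2)
    then have "a = 1 \<or> a = -1" using eq by (simp add: power2_eq_1_iff)
    then show False using \<open>?N a = -1\<close> N1 Nm1 by auto
  qed
  have distinct: "coset 1 \<noteq> coset (-1)"
  proof
    assume "coset 1 = coset (-1)"
    then obtain a where "a \<in> ?U" "1 = ?N a / a\<^sup>2 * (-1)" using self[of 1] by (auto simp: coset_def)
    then show False using no_m1[of a] galois_norm_unit(4)[of a] by (simp add: field_simps)
  qed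
  show ?thesis
  proof
    assume N: "?N \<epsilon> = -1"
    have "coset v \<in> {coset 1, coset (-1)}" if "v \<in> V" for v
    proof -
      have v: "v \<in> ?U" "?N v = 1" using that by (auto simp: V_def)
      obtain b where b: "b \<in> ?U" and "\<bar>v\<bar> = b * b"
        by (rule unit_mod_squares[OF \<epsilon> v(1)]) (use that N v(2) in auto)
      have "b \<noteq> 0" using b by (rule galois_norm_unit)
      \<comment> \<open>As \<open>N(b) = \<plusminus>1\<close>, dividing \<open>v\<close> by the element \<open>N(b) b\<^sup>2\<close> of \<open>W\<close>, the quotient for \<open>a = 1 / b\<close>, leaves the sign \<open>e\<close>.\<close>
      define e where "e = ?N b * sgn v"
      have "v = sgn v * (b * b)" using \<open>\<bar>v\<bar> = b * b\<close> by (metis sgn_mult_abs)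
      then have v_eq: "v = e * ?N b * (b * b)"
        using galois_norm_unit(2)[OF b] by (auto simp: e_def)
      have "e = 1 \<or> e = -1" using galois_norm_unit(2)[OF b] galois_norm_unit(4)[OF v(1)]
        by (auto simp: e_def sgn_if)
      moreover have "coset v = coset e"
      proof (intro equalityI subsetI)
        fix x assume "x \<in> coset v"
        then obtain a where a: "a \<in> ?U" "x = ?N a / a\<^sup>2 * v" by (auto simp: coset_def)
        define c where "c = a * inverse b"
        have c: "c \<in> ?U" unfolding c_def using a b by (intro unit_mult unit_inverse)
        have "c * b = a" using \<open>b \<noteq> 0\<close> by (simp add: c_def)
        then have "?N c * ?N b = ?N a"
          using galois_norm_mult[OF unit_in_K[OF c] unit_in_K[OF b]] by simp
        then have "?N c = ?N a * ?N b" using galois_norm_unit(2)[OF b] by auto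
        then have "x = ?N c / c\<^sup>2 * e" 
          unfolding a(2) v_eq using \<open>b \<noteq> 0\<close> by (simp add: c_def power2_eq_square field_simps)
        then show "x \<in> coset e" unfolding coset_def using c by blast
      next
        fix x assume "x \<in> coset e"
        then obtain a where a: "a \<in> ?U" "x = ?N a / a\<^sup>2 * e" by (auto simp: coset_def)
        have c: "a * b \<in> ?U" using a b by (intro unit_mult)
        have "?N (a * b) * ?N b = ?N a" 
          using galois_norm_mult[OF unit_in_K[OF a(1)] unit_in_K[OF b]] galois_norm_unit(2)[OF b] by auto
        then have "x = ?N (a * b) / (a * b)\<^sup>2 * v" 
          unfolding a(2) v_eq using \<open>b \<noteq> 0\<close> by (simp add: power2_eq_square field_simps)
        then show "x \<in> coset v" unfolding coset_def using c by blast
      qed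
      ultimately show ?thesis by auto
    qed
    then have "coset ` V = {coset 1, coset (-1)}" using V1 by blast
    then show "card (carrier (H1 (gal_group K) (unit_group K) (\<lambda>\<sigma> u. \<sigma> u))) = 2"
      using card distinct by simp
  next
    assume two: "card (carrier (H1 (gal_group K) (unit_group K) (\<lambda>\<sigma> u. \<sigma> u))) = 2"
    show "?N \<epsilon> = -1"
    proof (rule ccontr)
      assume "?N \<epsilon> \<noteq> -1"
      then have "?N u \<noteq> -1" if "u \<in> ?U" for u
        using galois_norm_fundamental_unit_iff[OF \<epsilon>] that by auto
      then have N: "?N u = 1" if "u \<in> ?U" for u
        using galois_norm_unit(2)[OF that] that by auto
      have "\<epsilon> \<in> V" using \<epsilon>U N[OF \<epsilon>U] by (simp add: V_def)
      have notin: "\<epsilon> \<notin> coset e" if e: "e = 1 \<or> e = -1" for e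
      proof
        assume "\<epsilon> \<in> coset e"
        then obtain a where a: "a \<in> ?U" and "\<epsilon> = ?N a / a\<^sup>2 * e" unfolding coset_def by blast
        then have \<epsilon>_eq: "\<epsilon> = 1 / a\<^sup>2 * e" by (simp only: N)
        have "e \<noteq> -1"
        proof
          assume "e = -1"
          then have "\<epsilon> \<le> 0" unfolding \<epsilon>_eq by simp
          then show False using \<open>1 < \<epsilon>\<close> by simp
        qed
        then have "e = 1" using e by simp
        define v where "v = \<bar>inverse a\<bar>"
        have v: "v \<in> ?U" unfolding v_def using unit_inverse[OF a] unit_minus by (auto simp: abs_if)
        have vv: "v * v = \<epsilon>" using \<epsilon>_eq \<open>e = 1\<close> by (simp add: v_def power2_eq_square field_simps flip: abs_mult)
        have "v \<ge> 0" by (simp add: v_def)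
        have "1 < v" using vv \<open>1 < \<epsilon>\<close> \<open>v \<ge> 0\<close> mult_le_one[of v v] by force
        moreover from this have "v < \<epsilon>" using vv by auto
        ultimately show False using fundamental_unit_not_between[OF \<epsilon> v] by simp
      qed
      then have "coset \<epsilon> \<noteq> coset 1" "coset \<epsilon> \<noteq> coset (-1)" using self[of \<epsilon>] by auto
      then have "card {coset 1, coset (-1), coset \<epsilon>} = 3" using distinct by simp
      moreover have "{coset 1, coset (-1), coset \<epsilon>} \<subseteq> coset ` V" using V1 \<open>\<epsilon> \<in> V\<close> by blast
      moreover have "finite (coset ` V)" using two card by (intro card_ge_0_finite) simp
      ultimately have "3 \<le> card (coset ` V)" using card_mono by metis
      then show False using two card by simp
    qed
  qed
qed

end

theorem proposition3p3:
  fixes D :: int and K :: "real ring" and G :: "(real \<Rightarrow> real) monoid" and \<epsilon> :: real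
  assumes "squarefree D" and "D > 0" and "D \<noteq> 1"
    and "K = quadratic_field D"
    and "G = gal_group K"
    and "is_fundamental_unit K \<epsilon>"
  shows "(galois_norm K \<epsilon> = -1
            \<longleftrightarrow> card (carrier (H1 G (unit_group K) (\<lambda>\<sigma> u. \<sigma> u))) = 2) \<and>
         (card (carrier (H1 G (unit_group K) (\<lambda>\<sigma> u. \<sigma> u))) = 2
            \<longleftrightarrow> ((D mod 4 \<in> {2, 3} \<longrightarrow> (\<exists>x y :: int. x\<^sup>2 - y\<^sup>2 * D = -1)) \<and>
                 (D mod 4 = 1 \<longrightarrow> (\<exists>x y :: int. (2 * x - y)\<^sup>2 - y\<^sup>2 * D = -4))))"
proof -
  interpret real_quadratic D using assms(1-3) by unfold_locales
  have \<epsilon>: "is_fundamental_unit (quadratic_field D) \<epsilon>" using assms(4,6) by simp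
  have "galois_norm (quadratic_field D) \<epsilon> = -1 \<longleftrightarrow> (\<exists>t s. t\<^sup>2 - D * s\<^sup>2 = -4)"
    using galois_norm_fundamental_unit_iff[OF \<epsilon>] unit_norm_neg_iff by simp
  then show ?thesis
    unfolding assms(4,5) negative_pell_iff[symmetric] using card_H1_eq_2_iff[OF \<epsilon>] by blast
qed

end
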